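(* Let $\mathbf A$ be a connexive Heyting algebra. For all $a,b\in A$: $a\rightarrow b=1$ if and only if $a\le b$ and $\neg a=\neg b$.
   Context: A connexive Heyting algebra is an algebra $\langle A,\wedge,\vee,\rightarrow,0,1\rangle$ whose $\{\wedge,\vee,0,1\}$-reduct is a bounded distributive lattice with lattice order $\le$, satisfying, with $\neg x:=x\rightarrow0$: (C1) $(x\rightarrow y)\rightarrow((y\rightarrow z)\rightarrow(x\rightarrow z))=1$; (C2) $(x\rightarrow y)\rightarrow\neg(x\rightarrow\neg y)=1$; (C3) $x\wedge(x\rightarrow y)=x\wedge y$; (C4) $x\rightarrow y\le(z\wedge x)\rightarrow(z\wedge y)$; (C5) $x\rightarrow y\le(z\vee x)\rightarrow(z\vee y)$. *)

theory Defs
  imports Main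
begin

unbundle lattice_syntax

class bounded_distrib_lattice_imp = distrib_lattice + bounded_lattice +
  fixes cimp :: "'a \<Rightarrow> 'a \<Rightarrow> 'a"  (infixr "\<rightarrow>\<^sub>c" 60)
begin

definition cneg :: "'a \<Rightarrow> 'a"  ("\<not>\<^sub>c _" [80] 80)
  where "\<not>\<^sub>c x = x \<rightarrow>\<^sub>c \<bottom>"

end

class connexive_heyting_algebra = bounded_distrib_lattice_imp +
  assumes C1: "(x \<rightarrow>\<^sub>c y) \<rightarrow>\<^sub>c ((y \<rightarrow>\<^sub>c z) \<rightarrow>\<^sub>c (x \<rightarrow>\<^sub>c z)) = \<top>"
    and C2: "(x \<rightarrow>\<^sub>c y) \<rightarrow>\<^sub>c \<not>\<^sub>c (x \<rightarrow>\<^sub>c \<not>\<^sub>c y) = \<top>"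
    and C3: "x \<sqinter> (x \<rightarrow>\<^sub>c y) = x \<sqinter> y"
    and C4: "(x \<rightarrow>\<^sub>c y) \<le> ((z \<sqinter> x) \<rightarrow>\<^sub>c (z \<sqinter> y))"
    and C5: "(x \<rightarrow>\<^sub>c y) \<le> ((z \<squnion> x) \<rightarrow>\<^sub>c (z \<squnion> y))"

end

theory Submission
  imports Defs
begin

text \<open>
  The negation is a pseudocomplement, and \<open>x \<rightarrow> y = 1\<close> always entails \<open>x \<le> y\<close> and \<open>\<not> y \<le> \<not> x\<close>.
  If \<open>a \<rightarrow> b = 1\<close>, then meeting with \<open>c = b \<and> \<not> a\<close> gives \<open>0 \<rightarrow> c = 1\<close>; the connexive law (C2)
  forces \<open>c = 0\<close>, whence \<open>\<not> a \<le> \<not> b\<close>. Conversely \<open>a \<rightarrow> \<not>\<not>a = 1\<close> by (C1), and meeting with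
  \<open>b \<le> \<not>\<not>b = \<not>\<not>a\<close> yields \<open>a \<rightarrow> b = 1\<close>.
\<close>

context connexive_heyting_algebra
begin

lemma top_cimp [simp]: "\<top> \<rightarrow>\<^sub>c x = x"
  using C3[of \<top> x] by simp

text \<open>Implication from top is the identity, so C1 with its first two arguments top collapses
  to this.\<close>

lemma cimp_refl [simp]: "x \<rightarrow>\<^sub>c x = \<top>"
  using C1[of \<top> \<top> x] by simp

lemma inf_cneg [simp]: "x \<sqinter> \<not>\<^sub>c x = \<bottom>"
  using C3[of x \<bottom>] by (simp add: cneg_def)

lemma cneg_eq_topD: "\<not>\<^sub>c x = \<top> \<Longrightarrow> x = \<bottom>"
  using inf_cneg[of x] by simp

lemma cimp_eq_topD: "x \<rightarrow>\<^sub>c y = \<top> \<Longrightarrow> x \<le> y"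
  using C3[of x y] by (simp add: le_iff_inf)

lemma cimp_eq_top_trans:
  assumes "x \<rightarrow>\<^sub>c y = \<top>"
  shows "(y \<rightarrow>\<^sub>c z) \<rightarrow>\<^sub>c (x \<rightarrow>\<^sub>c z) = \<top>"
  using C1[of x y z] assms by simp

lemma cimp_eq_top_cneg_le: "x \<rightarrow>\<^sub>c y = \<top> \<Longrightarrow> \<not>\<^sub>c y \<le> \<not>\<^sub>c x"
  using cimp_eq_topD[OF cimp_eq_top_trans[of x y \<bottom>]] by (simp add: cneg_def)

lemma cimp_cneg_eq_bot: "x \<rightarrow>\<^sub>c y = \<top> \<Longrightarrow> x \<rightarrow>\<^sub>c \<not>\<^sub>c y = \<bottom>"
  using C2[of x y] by (simp add: cneg_eq_topD)

lemma le_cneg_iff: "x \<le> \<not>\<^sub>c y \<longleftrightarrow> x \<sqinter> y = \<bottom>"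
proof
  assume "x \<le> \<not>\<^sub>c y"
  then have "x \<sqinter> y \<le> y \<sqinter> \<not>\<^sub>c y"
    by (metis inf_commute inf_mono order_refl)
  then show "x \<sqinter> y = \<bottom>"
    by (simp add: bot_unique)
next
  assume "x \<sqinter> y = \<bottom>"
  \<comment> \<open>Read \<open>x\<close> as \<open>\<top> \<rightarrow>\<^sub>c x\<close>; C4 then
    meets both sides with \<open>y\<close>.\<close>
  then show "x \<le> \<not>\<^sub>c y"
    using C4[of \<top> x y] by (simp add: cneg_def inf_commute)
qed

lemma le_cneg_cneg: "x \<le> \<not>\<^sub>c \<not>\<^sub>c x"
  by (simp add: le_cneg_iff)

text \<open>C1 along top, \<open>x\<close>, bottom.\<close>

lemma cimp_cneg_cneg [simp]: "x \<rightarrow>\<^sub>c \<not>\<^sub>c \<not>\<^sub>c x = \<top>"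
  using C1[of \<top> x \<bottom>] by (simp add: cneg_def)

lemma bot_cimp_eq_topD:
  assumes "\<bottom> \<rightarrow>\<^sub>c x = \<top>"
  shows "x = \<bottom>"
proof -
  have "\<not>\<^sub>c x \<rightarrow>\<^sub>c \<top> = \<top>"
    using cimp_eq_top_trans[OF assms, of \<bottom>] by (simp add: cneg_def)
  \<comment> \<open>C2 gives \<open>\<not>\<^sub>c x \<rightarrow>\<^sub>c \<not>\<^sub>c \<top> =
    \<bottom>\<close>, and \<open>\<not>\<^sub>c \<top>\<close> is bottom.\<close>
  then have "\<not>\<^sub>c \<not>\<^sub>c x = \<bottom>"
    using cimp_cneg_eq_bot[of "\<not>\<^sub>c x" \<top>] by (simp add: cneg_def)
  then show ?thesis
    using le_cneg_cneg[of x] by (simp add: bot_unique)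
qed

lemma cimp_eq_top_iff: "x \<rightarrow>\<^sub>c y = \<top> \<longleftrightarrow> x \<le> y \<and> \<not>\<^sub>c x = \<not>\<^sub>c y"
proof
  assume xy: "x \<rightarrow>\<^sub>c y = \<top>"
  let ?c = "\<not>\<^sub>c x \<sqinter> y"
  have "?c \<sqinter> x = \<bottom>"
    by (metis inf_assoc inf_bot_right inf_cneg inf_commute)
  \<comment> \<open>Under the meet with \<open>?c\<close>, \<open>x\<close> vanishes and
    \<open>y\<close> becomes \<open>?c\<close>.\<close>
  then have "\<bottom> \<rightarrow>\<^sub>c ?c = \<top>"
    using C4[of x y ?c] xy by (simp add: top_unique inf_assoc)
  then have "\<not>\<^sub>c x \<le> \<not>\<^sub>c y"
    by (simp add: le_cneg_iff bot_cimp_eq_topD)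
  then show "x \<le> y \<and> \<not>\<^sub>c x = \<not>\<^sub>c y"
    using xy by (simp add: cimp_eq_topD cimp_eq_top_cneg_le order.antisym)
next
  assume xy: "x \<le> y \<and> \<not>\<^sub>c x = \<not>\<^sub>c y"
  then have y: "y \<le> \<not>\<^sub>c \<not>\<^sub>c x"
    using le_cneg_cneg[of y] by simp
  \<comment> \<open>The meet with \<open>y\<close> fixes \<open>x\<close> and cuts the double
    negation down to \<open>y\<close>.\<close>
  show "x \<rightarrow>\<^sub>c y = \<top>"
    using C4[of x "\<not>\<^sub>c \<not>\<^sub>c x" y] y conjunct1[OF xy] by (simp add: inf_absorb1 inf_absorb2 top_unique)
qed

end

theorem theorem3p7:
  fixes a b :: "'a :: connexive_heyting_algebra"
  shows "a \<rightarrow>\<^sub>c b = \<top> \<longleftrightarrow> a \<le> b \<and> \<not>\<^sub>c a = \<not>\<^sub>c b"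
  by (rule cimp_eq_top_iff)

end
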